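(* Let $S \subset \mathbb{R}^2$ be a set of diameter $d>0$ with $a(S)=3$, and let $C$ be the unique plane convex body of constant width $d$ that contains $S$. Then for every positive integer $k$, we have $a_k(S)=a_k(C)$.
   Context: For a set $S\subset\mathbb{R}^n$ of diameter $d>0$ (finite) and a positive integer $k$, the $k$-fold Borsuk number $a_k(S)$ is the smallest positive integer $m$ such that there is a $k$-fold cover of $S$ with $m$ sets of diameters strictly less than $d$. A $k$-fold cover of $S$ is a family of sets such that any point of $S$ belongs to at least $k$ members of the family; some members of the family are permitted to coincide (they are counted with multiplicity). The Borsuk number is $a(S)=a_1(S)$. A convex body is a compact convex set with nonempty interior; it has constant width $d$ if the distance between any two of its parallel supporting lines is $d$. By a known theorem of Boltyanskii, a set $S\subset\mathbb{R}^2$ of diameter $d>0$ satisfies $a(S)=3$ if and only if there is a unique convex body of constant width $d$ containing $S$; so $C$ is well defined. *)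

theory Defs
  imports "HOL-Analysis.Analysis"
begin

text \<open>
  The members of a cover are indexed by \<open>i < m\<close>, so that coinciding sets are counted with
  multiplicity. Boundedness is required explicitly because \<^const>\<open>diameter\<close> is a real-valued
  supremum, which is unspecified on unbounded sets.
\<close>

definition kfold_cover :: "nat \<Rightarrow> 'a set \<Rightarrow> nat \<Rightarrow> (nat \<Rightarrow> 'a set) \<Rightarrow> bool" where
  "kfold_cover k S m F \<longleftrightarrow> (\<forall>x\<in>S. k \<le> card {i. i < m \<and> x \<in> F i})"

definition kfold_borsuk_number :: "nat \<Rightarrow> 'a::euclidean_space set \<Rightarrow> nat" where
  "kfold_borsuk_number k S =
     (LEAST m. 0 < m \<and>
        (\<exists>F. kfold_cover k S m F \<and>
             (\<forall>i<m. bounded (F i) \<and> diameter (F i) < diameter S)))"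

abbreviation borsuk_number :: "'a::euclidean_space set \<Rightarrow> nat" where
  "borsuk_number S \<equiv> kfold_borsuk_number 1 S"

definition convex_body :: "'a::euclidean_space set \<Rightarrow> bool" where
  "convex_body C \<longleftrightarrow> compact C \<and> convex C \<and> interior C \<noteq> {}"

text \<open>Replacing \<open>u, b\<close> by \<open>- u, - b\<close> yields the hyperplanes with \<open>C\<close> on the other side.\<close>

definition supporting_hyperplane :: "'a::euclidean_space set \<Rightarrow> 'a set \<Rightarrow> bool" where
  "supporting_hyperplane C H \<longleftrightarrow>
     (\<exists>u b. u \<noteq> 0 \<and> H = {x. u \<bullet> x = b} \<and> C \<subseteq> {x. u \<bullet> x \<le> b} \<and> C \<inter> H \<noteq> {})"

text \<open>
  The two hyperplanes are required to be distinct since \<^const>\<open>affine_parallel\<close> is reflexive.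
\<close>

definition has_constant_width :: "'a::euclidean_space set \<Rightarrow> real \<Rightarrow> bool" where
  "has_constant_width C d \<longleftrightarrow>
     (\<forall>H H'. supporting_hyperplane C H \<and> supporting_hyperplane C H' \<and>
             affine_parallel H H' \<and> H \<noteq> H' \<longrightarrow> setdist H H' = d)"

end

theory Submission
  imports Defs
begin

text \<open>
  A body \<open>C\<close> of constant width \<open>d\<close> has diameter \<open>d\<close>, so a cover of \<open>C\<close> by sets of diameter less than
  \<open>d\<close> is such a cover of \<open>S\<close>. The content of the theorem is the converse: every \<open>k\<close>-fold cover of
  \<open>S\<close> by \<open>m\<close> sets of diameter less than \<open>d\<close> gives one of \<open>C\<close> by \<open>m\<close> such sets. It suffices to
  cover the boundary of \<open>C\<close>, since every set of the cover can afterwards be joined by segments to a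
  fixed interior point, which stays at distance less than \<open>d\<close> from \<open>C\<close>
  (\<open>kfold_cover_extend_to_body\<close>).

  Let \<open>T\<close> be the closure of \<open>S\<close>, and let \<open>p\<close> be a boundary point of \<open>C\<close> outside \<open>T\<close>. By constant
  width there is \<open>q \<in> C\<close> with \<open>dist p q = d\<close>. Any two diametral chords of a plane set meet; hence two
  points of \<open>C\<close> at distance \<open>d\<close> that lie on the same side of the line \<open>p q\<close> include \<open>p\<close> or \<open>q\<close>.
  Cutting \<open>T\<close> along this line therefore yields two pieces of diameter less than \<open>d\<close>, contrary to
  the Borsuk number being 3, unless \<open>q \<in> T\<close>. Even if \<open>q \<in> T\<close>, the cut can be repaired
  by giving a small disc around \<open>q\<close> to just one piece, unless \<open>T\<close> contains points at distance \<open>d\<close>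
  from \<open>q\<close> on both sides of the line. So such points exist: \<open>p\<close> lies strictly inside an arc of
  radius \<open>d\<close> around \<open>q\<close> whose ends belong to \<open>T\<close>. This makes \<open>q\<close> the only point of \<open>C\<close> at distance
  \<open>d\<close> from \<open>p\<close> (\<open>frontier_partner_outside\<close>).

  Consequently \<open>p\<close> may be put into all the sets of the cover that contain an end \<open>e \<in> T\<close> of its arc:
  the only conflict could be with \<open>q\<close>, and no set of the cover containing \<open>e\<close> contains \<open>q\<close>, because
  \<open>dist e q = d\<close>. To keep the diameters bounded away from \<open>d\<close>, boundary points close to \<open>S\<close> are
  instead covered by slightly thickening the given sets, and the arc rule is applied only at a
  positive distance from \<open>S\<close>, where \<open>q\<close> depends continuously on \<open>p\<close>
  (\<open>kfold_cover_extend_to_frontier\<close>).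
\<close>

section \<open>Plane geometry of diametral pairs\<close>

definition cross2 :: "real ^ 2 \<Rightarrow> real ^ 2 \<Rightarrow> real" where
  "cross2 v w = v $ 1 * w $ 2 - v $ 2 * w $ 1"

text \<open>
  The numbers \<open>v \<bullet> z\<close> and \<open>cross2 v z\<close> are the coordinates of \<open>z\<close> along \<open>v\<close> and across it, scaled
  by the norm of \<open>v\<close>; the sign of \<open>cross2 v z\<close> tells the two sides of the line spanned by \<open>v\<close> apart.
\<close>

lemma inner_cross2_squares:
  "(v \<bullet> v) * (z \<bullet> z) = (v \<bullet> z)\<^sup>2 + (cross2 v z)\<^sup>2"
  by (simp add: cross2_def inner_vec_def sum_2 power2_eq_square algebra_simps)

lemma cross2_diff_right: "cross2 v (x - y) = cross2 v x - cross2 v y"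
  by (simp add: cross2_def algebra_simps)

lemma cross2_self [simp]: "cross2 v v = 0"
  by (simp add: cross2_def)

lemma cross2_jacobi:
  "cross2 x y *\<^sub>R v = cross2 v y *\<^sub>R x - cross2 v x *\<^sub>R y"
  by (simp add: cross2_def vec_eq_iff forall_2 algebra_simps)

lemma continuous_on_cross2 [continuous_intros]:
  "continuous_on A f \<Longrightarrow> continuous_on A (\<lambda>x. cross2 v (f x))"
  unfolding cross2_def by (intro continuous_intros)

lemma dist_le_iff_inner:
  fixes x y :: "'a::real_inner"
  assumes "0 \<le> d"
  shows "dist x y \<le> d \<longleftrightarrow> (x - y) \<bullet> (x - y) \<le> d\<^sup>2"
  using assms by (metis dist_norm norm_le_square)

lemma dist_eq_iff_inner:
  fixes x y :: "'a::real_inner"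
  assumes "0 \<le> d"
  shows "dist x y = d \<longleftrightarrow> (x - y) \<bullet> (x - y) = d\<^sup>2"
  using assms by (metis dist_norm norm_eq_square)

text \<open>
  The coordinate form of \<open>diametral_pair_one_side\<close>, with \<open>q\<close> at the origin and \<open>p\<close> at \<open>(0, D)\<close>.
  Project the point \<open>(a', b')\<close>, which is the closer one to the axis, onto the axis. This does not
  decrease its distance from \<open>(a, b)\<close>. The foot \<open>(0, b')\<close> lies between \<open>p\<close> and \<open>q\<close>, and by strict
  convexity of the squared distance its distance from \<open>(a, b)\<close> is less than \<open>D\<close>
  unless it is one of the ends.
\<close>

lemma diametral_pair_one_side_aux:
  fixes a a' b b' D :: real
  assumes D: "0 < D"
    and x1: "a\<^sup>2 + b\<^sup>2 \<le> D\<^sup>2" and x2: "a\<^sup>2 + (b - D)\<^sup>2 \<le> D\<^sup>2"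
    and y1: "a'\<^sup>2 + b'\<^sup>2 \<le> D\<^sup>2" and y2: "a'\<^sup>2 + (b' - D)\<^sup>2 \<le> D\<^sup>2"
    and xy: "(a - a')\<^sup>2 + (b - b')\<^sup>2 = D\<^sup>2"
    and side: "0 \<le> a'" "a' \<le> a"
  shows "a' = 0 \<and> (b' = 0 \<or> b' = D)"
proof -
  have "b'\<^sup>2 \<le> D\<^sup>2" "(D - b')\<^sup>2 \<le> D\<^sup>2"
    using y1 y2 zero_le_power2[of a'] unfolding power2_commute[of D b'] by linarith+
  then have b': "0 \<le> b'" "b' \<le> D"
    using D power2_le_imp_le[of b' D] power2_le_imp_le[of "D - b'" D] by auto
  \<comment> \<open>Strict convexity along the axis: the last product is the defect between the foot and the ends.\<close>
  have "D * (a\<^sup>2 + (b - b')\<^sup>2)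
      = (D - b') * (a\<^sup>2 + b\<^sup>2) + b' * (a\<^sup>2 + (b - D)\<^sup>2) - b' * (D - b') * D"
    by (simp add: power2_eq_square algebra_simps)
  also have "\<dots> \<le> (D - b') * D\<^sup>2 + b' * D\<^sup>2 - b' * (D - b') * D"
    using x1 x2 b' by (intro diff_mono add_mono mult_left_mono) auto
  also have "\<dots> = D * (D\<^sup>2 - b' * (D - b'))"
    by (simp add: power2_eq_square algebra_simps)
  finally have "a\<^sup>2 + (b - b')\<^sup>2 \<le> D\<^sup>2 - b' * (D - b')"
    using D by simp
  then have le: "a' * (2 * a - a') + b' * (D - b') \<le> 0"
    using xy by (simp add: power2_eq_square algebra_simps)
  have "0 \<le> b' * (D - b')" "0 \<le> a' * (2 * a - a')"
    using b' side by auto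
  then have "a' * (2 * a - a') = 0" "b' * (D - b') = 0"
    using le by linarith+
  then show ?thesis using side by auto
qed

text \<open>
  Two diametral chords of a plane set meet: if \<open>x\<close> and \<open>y\<close> lie on one closed side of the line \<open>p q\<close>,
  the chords can meet only at an end of one of them. The factor \<open>s\<close> selects the side, so that both
  sides are treated at once.
\<close>

lemma diametral_pair_one_side:
  fixes p q x y :: "real ^ 2"
  assumes d: "0 < d"
    and le: "\<And>u v. u \<in> {p, q, x, y} \<Longrightarrow> v \<in> {p, q, x, y} \<Longrightarrow> dist u v \<le> d"
    and pq: "dist p q = d" and xy: "dist x y = d"
    and s: "s \<noteq> 0" "0 \<le> s * cross2 (p - q) (x - q)" "0 \<le> s * cross2 (p - q) (y - q)"
  shows "x = p \<or> x = q \<or> y = p \<or> y = q"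
proof -
  \<comment> \<open>The situation is symmetric in \<open>x\<close> and \<open>y\<close>; here \<open>y\<close> is the point closer to the line.\<close>
  have main: "y = p \<or> y = q"
    if le: "\<And>u v. u \<in> {p, q, x, y} \<Longrightarrow> v \<in> {p, q, x, y} \<Longrightarrow> dist u v \<le> d"
      and xy: "dist x y = d" and s: "0 \<le> sgn s * cross2 (p - q) (y - q)"
      and cmp: "sgn s * cross2 (p - q) (y - q) \<le> sgn s * cross2 (p - q) (x - q)" for x y
  proof -
    define D v c where "D = d\<^sup>2" and "v = p - q" and "c = (\<lambda>z. sgn s * cross2 v z)"
    have D: "D > 0" "v \<bullet> v = D"
      using d pq by (auto simp: D_def v_def dist_eq_iff_inner)
    have sq: "(c z)\<^sup>2 + (v \<bullet> z)\<^sup>2 = D * (z \<bullet> z)" for z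
      using inner_cross2_squares[of v z] D s \<open>s \<noteq> 0\<close>
      by (auto simp: c_def power_mult_distrib sgn_if)
    have sq': "(c z)\<^sup>2 + (v \<bullet> z - D)\<^sup>2 = D * ((z - v) \<bullet> (z - v))" for z
      using sq[of z] D by (simp add: power2_eq_square algebra_simps inner_commute)
    have cd: "c (x - y) = c x - c y" for x y
      by (simp add: c_def cross2_diff_right algebra_simps)
    have in1: "(z - q) \<bullet> (z - q) \<le> D" "(z - q - v) \<bullet> (z - q - v) \<le> D"
      if "z \<in> {x, y}" for z
      using le[of z q] le[of z p] that d by (auto simp: D_def v_def dist_le_iff_inner)
    have in2: "(c (z - q))\<^sup>2 + (v \<bullet> (z - q))\<^sup>2 \<le> D\<^sup>2"
      "(c (z - q))\<^sup>2 + (v \<bullet> (z - q) - D)\<^sup>2 \<le> D\<^sup>2" if "z \<in> {x, y}" for z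
      unfolding sq sq' power2_eq_square[of D]
      using mult_left_mono[OF in1(1)[OF that], of D] mult_left_mono[OF in1(2)[OF that], of D] D(1)
      by linarith+
    have "(c (x - q) - c (y - q))\<^sup>2 + (v \<bullet> (x - q) - v \<bullet> (y - q))\<^sup>2 = D\<^sup>2"
      using sq[of "(x - q) - (y - q)"] xy d
      by (simp add: cd inner_diff_right D_def dist_eq_iff_inner power2_eq_square)
    from diametral_pair_one_side_aux[OF D(1) in2[of x] in2[of y] this]
    have "c (y - q) = 0" "v \<bullet> (y - q) = 0 \<or> v \<bullet> (y - q) = D"
      using s cmp by (auto simp: c_def v_def)
    then have "(y - q) \<bullet> (y - q) = 0 \<or> (y - q - v) \<bullet> (y - q - v) = 0"
      using sq[of "y - q"] sq'[of "y - q"] D by auto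
    then show ?thesis by (auto simp: v_def)
  qed
  have sg: "0 \<le> sgn s * cross2 (p - q) (x - q)" "0 \<le> sgn s * cross2 (p - q) (y - q)"
    using s by (auto simp: sgn_if zero_le_mult_iff)
  show ?thesis
  proof (cases "sgn s * cross2 (p - q) (y - q) \<le> sgn s * cross2 (p - q) (x - q)")
    case True
    then show ?thesis using main[of x y] le xy sg by blast
  next
    case False
    have "dist y x = d" using xy by (simp add: dist_commute)
    then show ?thesis using main[of y x] le sg False by (auto simp: insert_commute)
  qed
qed

text \<open>
  The vectors from \<open>p\<close> to \<open>e1\<close> and \<open>e2\<close> point to different sides of the line \<open>p q\<close> and backwards
  along \<open>p - q\<close>, so \<open>q - p\<close> is a positive combination of them. With \<open>z = q - q'\<close>, the bounds on
  \<open>dist e1 q'\<close> and \<open>dist e2 q'\<close> say that \<open>z\<close> has nonpositive inner product with both, hence with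
  \<open>q - p\<close>. But both \<open>q\<close> and \<open>q'\<close> are on the circle of radius \<open>d\<close> around \<open>p\<close>, which turns this into
  \<open>z \<bullet> z \<le> 0\<close>.
\<close>

lemma diametral_partner_unique:
  fixes p q q' e1 e2 :: "real ^ 2"
  assumes d: "0 < d" and pq: "dist p q = d" and pq': "dist p q' = d"
    and e1: "dist e1 q = d" "dist e1 q' \<le> d" "0 < cross2 (p - q) (e1 - q)"
    and e2: "dist e2 q = d" "dist e2 q' \<le> d" "cross2 (p - q) (e2 - q) < 0"
  shows "q' = q"
proof -
  define v z w1 w2 where "v = p - q" and "z = q - q'" and "w1 = e1 - p" and "w2 = e2 - p"
  have vv: "v \<bullet> v = d\<^sup>2" "v \<bullet> v > 0"
    using d pq by (auto simp: v_def dist_eq_iff_inner)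
  have zz: "z \<bullet> z = - 2 * (v \<bullet> z)"
  proof -
    have "p - q' = v + z" by (simp add: v_def z_def)
    then have "(v + z) \<bullet> (v + z) = d\<^sup>2" using pq' d by (metis dist_eq_iff_inner less_eq_real_def)
    then show ?thesis using vv by (simp add: algebra_simps inner_commute)
  qed
  have w: "(e - p) \<bullet> v \<le> 0" "(e - p) \<bullet> v \<noteq> 0 \<or> e = p" "(e - p) \<bullet> z \<le> 0"
    if "dist e q = d" "dist e q' \<le> d" for e
  proof -
    define w where "w = e - p"
    have eq: "e - q = w + v" "e - q' = w + v + z" by (simp_all add: w_def v_def z_def)
    have 1: "(w + v) \<bullet> (w + v) = d\<^sup>2" "(w + v + z) \<bullet> (w + v + z) \<le> d\<^sup>2"
      using that d by (auto simp: dist_eq_iff_inner dist_le_iff_inner eq)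
    then have "w \<bullet> w = - 2 * (w \<bullet> v)" using vv by (simp add: algebra_simps inner_commute)
    moreover have "w \<bullet> z \<le> 0" using 1 zz by (simp add: algebra_simps inner_commute)
    ultimately show "(e - p) \<bullet> v \<le> 0" "(e - p) \<bullet> v \<noteq> 0 \<or> e = p" "(e - p) \<bullet> z \<le> 0"
      using inner_ge_zero[of w] inner_eq_zero_iff[of w]
      unfolding w_def[symmetric] by (auto simp: w_def)
  qed
  have c: "0 < cross2 v w1" "cross2 v w2 < 0"
    using e1(3) e2(3) by (simp_all add: v_def w1_def w2_def cross2_def algebra_simps)
  have "w1 \<noteq> 0" using c by (auto simp: cross2_def)
  then have neg: "w1 \<bullet> v < 0" "w2 \<bullet> v \<le> 0" "w1 \<bullet> z \<le> 0" "w2 \<bullet> z \<le> 0"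
    using w[OF e1(1,2)] w[OF e2(1,2)] by (auto simp: w1_def w2_def less_le)
  \<comment> \<open>This expresses \<open>v\<close> as a combination of \<open>w1\<close> and \<open>w2\<close> with coefficients of known sign.\<close>
  have jac: "cross2 w1 w2 * (v \<bullet> y) = cross2 v w2 * (w1 \<bullet> y) - cross2 v w1 * (w2 \<bullet> y)" for y
    using arg_cong[OF cross2_jacobi[of w1 w2 v], of "\<lambda>u. u \<bullet> y"] by (simp add: inner_diff_left)
  have "0 < cross2 w1 w2 * (v \<bullet> v)"
    unfolding jac using c neg
    by (smt (verit) mult_neg_neg mult_nonneg_nonpos)
  then have pos: "0 < cross2 w1 w2" using vv by (simp add: zero_less_mult_iff)
  have "0 \<le> cross2 w1 w2 * (v \<bullet> z)"
    unfolding jac using c neg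
    by (smt (verit) mult_nonpos_nonpos mult_nonneg_nonpos)
  then have "0 \<le> v \<bullet> z" using pos by (simp add: zero_le_mult_iff)
  then have "z \<bullet> z = 0" using zz inner_ge_zero[of z] by linarith
  then show ?thesis by (simp add: z_def)
qed

section \<open>Splitting into two pieces along a diametral chord\<close>

definition splits_below :: "real \<Rightarrow> 'a::metric_space set \<Rightarrow> bool" where
  "splits_below d T \<longleftrightarrow>
     (\<exists>A B. bounded A \<and> bounded B \<and> T \<subseteq> A \<union> B \<and> diameter A < d \<and> diameter B < d)"

lemma diameter_less_compact:
  assumes "compact K" "0 < d" and "\<And>x y. x \<in> K \<Longrightarrow> y \<in> K \<Longrightarrow> dist x y < d"
  shows "diameter K < d"
proof (cases "K = {}")
  case False
  then obtain x y where "x \<in> K" "y \<in> K" "dist x y = diameter K"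
    using diameter_compact_attained[OF assms(1)] by blast
  then show ?thesis using assms(3)[of x y] by simp
qed (use assms(2) in simp)

text \<open>
  If neither \<open>p\<close> nor \<open>q\<close> belonged to \<open>T\<close>, the two closed sides of the line \<open>p q\<close> would cut \<open>T\<close>
  into compact pieces without a pair at distance \<open>d\<close>.
\<close>

lemma diametral_partner_in_set:
  fixes T :: "(real ^ 2) set"
  assumes T: "compact T" "p \<notin> T" and d: "0 < d" and pq: "dist p q = d"
    and le: "\<And>x y. x \<in> insert p (insert q T) \<Longrightarrow> y \<in> insert p (insert q T) \<Longrightarrow> dist x y \<le> d"
    and ns: "\<not> splits_below d T"
  shows "q \<in> T"
proof (rule ccontr)
  assume q: "q \<notin> T"
  define P where "P s = T \<inter> {x. 0 \<le> s * cross2 (p - q) (x - q)}" for s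
  have "compact (P s)" for s
    unfolding P_def using T
    by (intro compact_Int_closed closed_Collect_le continuous_intros) auto
  moreover have "dist x y < d" if "s \<noteq> 0" "x \<in> P s" "y \<in> P s" for s x y
  proof -
    have "dist x y \<noteq> d"
      using diametral_pair_one_side[of d p q x y s] le d pq that q T(2) unfolding P_def by blast
    then show ?thesis using le[of x y] that by (auto simp: P_def)
  qed
  ultimately have "diameter (P s) < d \<and> bounded (P s)" if "s \<noteq> 0" for s
    using diameter_less_compact[of "P s" d] d that compact_imp_bounded[of "P s"] by simp
  moreover have "T \<subseteq> P 1 \<union> P (-1)" by (auto simp: P_def)
  ultimately have "splits_below d T"
    unfolding splits_below_def by (intro exI[of _ "P 1"] exI[of _ "P (-1)"]) simp
  then show False using ns by simp
qed

text \<open>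
  Here \<open>q\<close> may belong to \<open>T\<close>, and then each closed side of the line \<open>p q\<close> may contain points at
  distance \<open>d\<close> from \<open>q\<close>. If the side selected by \<open>s\<close> contains none, this side with a small disc around \<open>q\<close> added and
  the other side with that disc removed still have diameter less than \<open>d\<close>.
\<close>

lemma diametral_point_on_each_side:
  fixes T :: "(real ^ 2) set"
  assumes T: "compact T" "p \<notin> T" and d: "0 < d" and pq: "dist p q = d"
    and le: "\<And>x y. x \<in> insert p (insert q T) \<Longrightarrow> y \<in> insert p (insert q T) \<Longrightarrow> dist x y \<le> d"
    and ns: "\<not> splits_below d T" and s: "s \<noteq> 0"
  shows "\<exists>e\<in>T. dist e q = d \<and> 0 < s * cross2 (p - q) (e - q)"
proof (rule ccontr)
  assume none: "\<not> ?thesis"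
  define P where "P s = T \<inter> {x. 0 \<le> s * cross2 (p - q) (x - q)}" for s
  have cP: "compact (P s)" for s
    unfolding P_def using T
    by (intro compact_Int_closed closed_Collect_le continuous_intros) auto
  have pair: "x = q \<or> y = q" if "s \<noteq> 0" "x \<in> P s" "y \<in> P s" "dist x y = d" for s x y
    using diametral_pair_one_side[of d p q x y s] le d pq that T(2) unfolding P_def by blast
  have qe: "dist e q < d" if e: "e \<in> P s" for e
  proof (rule ccontr)
    assume "\<not> ?thesis"
    then have dq: "dist e q = d" using le[of e q] e by (auto simp: P_def)
    \<comment> \<open>A point on the line at distance \<open>d\<close> from \<open>q\<close> is \<open>p\<close> or its reflection in \<open>q\<close>, which is too far from \<open>p\<close>.\<close>
    then have "s * cross2 (p - q) (e - q) = 0" using none e by (force simp: P_def)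
    then have c: "cross2 (p - q) (e - q) = 0" using s by simp
    have "d\<^sup>2 * d\<^sup>2 = ((p - q) \<bullet> (e - q))\<^sup>2"
      using inner_cross2_squares[of "p - q" "e - q"] c dq pq d
      by (simp add: dist_eq_iff_inner)
    then have "(p - q) \<bullet> (e - q) = d\<^sup>2 \<or> (p - q) \<bullet> (e - q) = - d\<^sup>2"
      by (metis power2_eq_iff power2_eq_square)
    moreover have "(e - p) \<bullet> (e - p) \<le> d\<^sup>2"
      using le[of e p] e d by (auto simp: P_def dist_le_iff_inner)
    moreover have "(e - p) \<bullet> (e - p) = 2 * d\<^sup>2 - 2 * ((p - q) \<bullet> (e - q))"
    proof -
      have "(e - p) \<bullet> (e - p)
          = (e - q) \<bullet> (e - q) + (p - q) \<bullet> (p - q) - 2 * ((p - q) \<bullet> (e - q))"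
        by (simp add: algebra_simps inner_commute)
      then show ?thesis using dq pq d by (simp add: dist_eq_iff_inner)
    qed
    ultimately have "(e - p) \<bullet> (e - p) = 0" using d zero_less_power[of d 2] by linarith
    then show False using e T(2) by (auto simp: P_def)
  qed
  define K where "K = insert q (P s)"
  have K: "compact K" "bounded K" using cP by (auto simp: K_def compact_imp_bounded)
  have "dist x y < d" if "x \<in> K" "y \<in> K" for x y
  proof -
    have "dist x y < d" if xy: "x \<in> P s" "y \<in> P s"
    proof -
      have "dist x y \<noteq> d"
        using pair[OF s xy] qe[OF xy(1)] qe[OF xy(2)] by (metis dist_commute less_irrefl)
      moreover have "dist x y \<le> d" using le[of x y] xy by (auto simp: P_def)
      ultimately show ?thesis by simp
    qed
    moreover have "dist q x < d" if "x \<in> P s" for x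
      using qe[OF that] by (simp add: dist_commute)
    ultimately show ?thesis using that qe d by (auto simp: K_def)
  qed
  then have dK: "diameter K < d" using diameter_less_compact[OF K(1) d] by simp
  have dK0: "0 \<le> diameter K" using diameter_ge_0 K by blast
  define r where "r = (d - diameter K) / 4"
  have r: "0 < r" "diameter K + 2 * r < d" using dK dK0 by (auto simp: r_def field_simps)
  define A B where "A = P s \<union> cball q r" and "B = P (-s) - ball q r"
  have "diameter A \<le> diameter K + 2 * r"
  proof (rule diameter_le)
    have near: "\<exists>x'\<in>K. dist x x' \<le> r" if "x \<in> A" for x
      using that r(1) by (auto simp: A_def K_def dist_commute intro: bexI[of _ x])
    fix x y assume "x \<in> A" "y \<in> A"
    then obtain x' y' where "x' \<in> K" "y' \<in> K" "dist x x' \<le> r" "dist y y' \<le> r"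
      using near by meson
    moreover have "dist x' y' \<le> diameter K"
      using diameter_bounded_bound K calculation by blast
    ultimately show "norm (x - y) \<le> diameter K + 2 * r"
      unfolding dist_norm[symmetric]
      using dist_triangle[of x y x'] dist_triangle[of x' y y'] by (simp add: dist_commute)
  qed (use dK0 r in auto)
  then have dA: "diameter A < d" using r by simp
  have "compact B" unfolding B_def using cP by (intro compact_diff) auto
  moreover have "dist x y < d" if "x \<in> B" "y \<in> B" for x y
  proof -
    have "x \<noteq> q" "y \<noteq> q" using that r by (auto simp: B_def)
    then have "dist x y \<noteq> d" using pair[of "-s" x y] s that by (auto simp: B_def)
    then show ?thesis using le[of x y] that by (auto simp: B_def P_def)
  qed
  ultimately have dB: "diameter B < d" "bounded B"
    using diameter_less_compact[of B d] d compact_imp_bounded[of B] by simp_all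
  have "T \<subseteq> A \<union> B" by (auto simp: A_def B_def P_def)
  moreover have "bounded A" using cP by (auto simp: A_def compact_imp_bounded)
  ultimately show False using dA dB ns unfolding splits_below_def by blast
qed


section \<open>Bodies of constant width\<close>

text \<open>
  The hyperplanes orthogonal to \<open>u\<close> through \<open>p\<close> and \<open>q\<close> support \<open>C\<close>, so their distance is the width
  \<open>d\<close>; it is at most \<open>dist p q\<close>, and at least the length of \<open>p - q\<close> along \<open>u\<close>.
\<close>

lemma constant_width_slab:
  fixes C :: "'a::euclidean_space set"
  assumes C: "convex_body C" "has_constant_width C d"
    and u: "u \<noteq> 0" and pq: "p \<in> C" "q \<in> C"
    and ext: "\<And>x. x \<in> C \<Longrightarrow> u \<bullet> q \<le> u \<bullet> x \<and> u \<bullet> x \<le> u \<bullet> p"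
  shows "d \<le> dist p q" and "u \<bullet> (p - q) \<le> norm u * d"
proof -
  define H H' where "H = {x. u \<bullet> x = u \<bullet> p}" and "H' = {x. u \<bullet> x = u \<bullet> q}"
  have "supporting_hyperplane C H"
    unfolding supporting_hyperplane_def H_def
    using u pq ext by (intro exI[of _ u] exI[of _ "u \<bullet> p"]) auto
  moreover have "supporting_hyperplane C H'"
    unfolding supporting_hyperplane_def H'_def
    using u pq ext by (intro exI[of _ "-u"] exI[of _ "-(u \<bullet> q)"]) auto
  moreover have "affine_parallel H H'"
  proof -
    have "H' = (\<lambda>x. (q - p) + x) ` H"
    proof (intro equalityI subsetI)
      fix x assume "x \<in> H'"
      then have "x - (q - p) \<in> H" by (simp add: H_def H'_def inner_diff_right)
      then show "x \<in> (\<lambda>x. (q - p) + x) ` H" by (intro image_eqI[of _ _ "x - (q - p)"]) auto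
    qed (auto simp: H_def H'_def inner_diff_right inner_add_right)
    then show ?thesis unfolding affine_parallel_def by blast
  qed
  \<comment> \<open>Equality would put \<open>C\<close> into a hyperplane, which has empty interior.\<close>
  moreover have "H \<noteq> H'"
  proof
    assume "H = H'"
    then have "u \<bullet> p = u \<bullet> q" by (auto simp: H_def H'_def)
    then have "C \<subseteq> H" using ext by (force simp: H_def)
    then have "interior C \<subseteq> interior H" by (rule interior_mono)
    then show False using C(1) u by (simp add: convex_body_def H_def interior_hyperplane)
  qed
  ultimately have w: "setdist H H' = d" using C(2) unfolding has_constant_width_def by blast
  show "d \<le> dist p q" using setdist_le_dist[of p H q H'] w by (simp add: H_def H'_def)
  have "(u \<bullet> (p - q)) / norm u \<le> setdist H H'"
  proof (rule le_setdistI)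
    show "H \<noteq> {}" "H' \<noteq> {}" by (auto simp: H_def H'_def)
    fix x y assume "x \<in> H" "y \<in> H'"
    then have "u \<bullet> (p - q) = u \<bullet> (x - y)" by (simp add: H_def H'_def inner_diff_right)
    also have "\<dots> \<le> norm u * norm (x - y)" by (rule norm_cauchy_schwarz)
    finally show "(u \<bullet> (p - q)) / norm u \<le> dist x y"
      using u by (simp add: dist_norm field_simps)
  qed
  then show "u \<bullet> (p - q) \<le> norm u * d" using w u by (simp add: field_simps)
qed

text \<open>
  The segment from \<open>y\<close> to \<open>x\<close> is no longer than the width of \<open>C\<close> in its own direction.
\<close>

lemma constant_width_dist_le:
  fixes C :: "'a::euclidean_space set"
  assumes C: "convex_body C" "has_constant_width C d" and d: "0 < d"
    and xy: "x \<in> C" "y \<in> C"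
  shows "dist x y \<le> d"
proof (cases "x = y")
  case False
  define u where "u = x - y"
  have u: "u \<noteq> 0" using False by (simp add: u_def)
  have K: "compact C" "C \<noteq> {}" using C xy by (auto simp: convex_body_def)
  have c: "continuous_on C ((\<bullet>) u)" by (intro continuous_intros)
  obtain p where p: "p \<in> C" "\<And>z. z \<in> C \<Longrightarrow> u \<bullet> z \<le> u \<bullet> p"
    using continuous_attains_sup[OF K c] by blast
  obtain q where q: "q \<in> C" "\<And>z. z \<in> C \<Longrightarrow> u \<bullet> q \<le> u \<bullet> z"
    using continuous_attains_inf[OF K c] by blast
  have "norm u * norm u = u \<bullet> x - u \<bullet> y"
    by (simp add: u_def inner_diff_right[symmetric] flip: power2_eq_square power2_norm_eq_inner)
  also have "\<dots> \<le> u \<bullet> (p - q)"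
    using p(2)[OF xy(1)] q(2)[OF xy(2)] by (simp add: inner_diff_right)
  also have "\<dots> \<le> norm u * d"
    using constant_width_slab(2)[OF C u p(1) q(1)] p q by blast
  finally show ?thesis using u by (simp add: u_def dist_norm)
qed (use d in simp)

text \<open>
  A support point \<open>q\<close> of \<open>C\<close> opposite to a supporting hyperplane at \<open>p\<close> is at distance at least the
  width \<open>d\<close> from \<open>p\<close>, and at most the diameter of \<open>C\<close>, which is also bounded by \<open>d\<close>.
\<close>

lemma constant_width_frontier_partner:
  fixes C :: "'a::euclidean_space set"
  assumes C: "convex_body C" "has_constant_width C d" and d: "0 < d"
    and p: "p \<in> frontier C"
  shows "\<exists>q\<in>C. dist p q = d"
proof -
  have K: "compact C" "C \<noteq> {}" "convex C" "interior C \<noteq> {}"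
    using C by (auto simp: convex_body_def)
  have pC: "p \<in> C" "p \<notin> rel_interior C"
    using p K by (auto simp: frontier_def compact_imp_closed rel_interior_nonempty_interior)
  obtain a where a: "a \<noteq> 0" "\<And>y. y \<in> C \<Longrightarrow> a \<bullet> p \<le> a \<bullet> y"
    using supporting_hyperplane_rel_boundary[OF K(3) pC] by metis
  have c: "continuous_on C ((\<bullet>) a)" by (intro continuous_intros)
  obtain q where q: "q \<in> C" "\<And>z. z \<in> C \<Longrightarrow> a \<bullet> z \<le> a \<bullet> q"
    using continuous_attains_sup[OF K(1,2) c] by blast
  have "d \<le> dist q p"
    using constant_width_slab(1)[OF C a(1) q(1) pC(1)] a q by blast
  then have "dist p q = d"
    using constant_width_dist_le[OF C d pC(1) q(1)] by (simp add: dist_commute)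
  then show ?thesis using q by blast
qed

lemma diameter_constant_width_superset:
  fixes C :: "'a::euclidean_space set"
  assumes C: "convex_body C" "has_constant_width C d" and d: "0 < d"
    and S: "S \<subseteq> C" "diameter S = d"
  shows "diameter C = d"
proof (rule antisym)
  show "diameter C \<le> d"
    using constant_width_dist_le[OF C d] d by (intro diameter_le) (auto simp: dist_norm)
  show "d \<le> diameter C"
    using diameter_subset[OF S(1)] C S(2) by (auto simp: convex_body_def compact_imp_bounded)
qed

text \<open>
  Since \<open>T\<close> cannot be split, it contains points at distance \<open>d\<close> from \<open>q\<close> on both sides of the line
  \<open>p q\<close>. Both are needed to see that \<open>q\<close> is the only partner of \<open>p\<close>; one of them is kept as \<open>e\<close>, the
  point whose sets in a cover \<open>p\<close> can join without meeting \<open>q\<close>.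
\<close>

lemma frontier_partner_outside:
  fixes C T :: "(real ^ 2) set"
  assumes C: "convex_body C" "has_constant_width C d" and d: "0 < d"
    and T: "compact T" "T \<subseteq> C" "\<not> splits_below d T"
    and p: "p \<in> frontier C" "p \<notin> T"
  shows "\<exists>q e. q \<in> T \<and> e \<in> T \<and> dist p q = d \<and> dist e q = d \<and>
               (\<forall>q'\<in>C. dist p q' = d \<longrightarrow> q' = q)"
proof -
  obtain q where q: "q \<in> C" "dist p q = d"
    using constant_width_frontier_partner[OF C d p(1)] by blast
  have "p \<in> C" using p C by (auto simp: convex_body_def frontier_def compact_imp_closed)
  then have le: "dist x y \<le> d"
    if "x \<in> insert p (insert q T)" "y \<in> insert p (insert q T)" for x y
    using constant_width_dist_le[OF C d] that q(1) T(2) by blast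
  have qT: "q \<in> T"
    using diametral_partner_in_set[OF T(1) p(2) d q(2) le T(3)] by blast
  obtain e1 where e1: "e1 \<in> T" "dist e1 q = d" "0 < cross2 (p - q) (e1 - q)"
    using diametral_point_on_each_side[OF T(1) p(2) d q(2) le T(3), of 1] by auto
  obtain e2 where e2: "e2 \<in> T" "dist e2 q = d" "cross2 (p - q) (e2 - q) < 0"
    using diametral_point_on_each_side[OF T(1) p(2) d q(2) le T(3), of "-1"] by auto
  have "q' = q" if "q' \<in> C" "dist p q' = d" for q'
    using diametral_partner_unique[OF d q(2) that(2) e1(2) _ e1(3) e2(2) _ e2(3)]
      constant_width_dist_le[OF C d] e1(1) e2(1) T(2) that(1) by blast
  then show ?thesis using qT e1 q by blast
qed

section \<open>Extending a cover from the set to the body\<close>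

text \<open>
  The set \<open>G i\<close> consists of the boundary points within \<open>\<delta>\<close> of \<open>F i\<close> and of those boundary points
  \<open>p\<close> at distance at least \<open>\<delta>\<close> from \<open>S\<close> whose substitute \<open>s p \<in> S\<close>, a point near an arc end at
  distance \<open>d\<close> from the partner \<open>q p\<close>, lies in \<open>F i\<close>. By compactness, \<open>G i\<close> has diameter
  less than \<open>d\<close> as soon as its closure contains no pair at distance \<open>d\<close>. A pair involving a point
  \<open>p\<close> of the second kind must be \<open>p\<close> and \<open>q p\<close>; but \<open>q p\<close> is in the closure of \<open>S\<close>, so it is of
  the first kind, and then \<open>F i\<close> has points both near \<open>q p\<close> and at distance nearly \<open>d\<close> from \<open>q p\<close>.
\<close>

lemma kfold_cover_extend_to_frontier:
  fixes S C :: "(real ^ 2) set"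
  assumes C: "convex_body C" "has_constant_width C d" and d: "0 < d"
    and S: "S \<subseteq> C" "\<not> splits_below d (closure S)"
    and F: "kfold_cover k S m F" "\<And>i. i < m \<Longrightarrow> bounded (F i) \<and> diameter (F i) < d"
  shows "\<exists>G. kfold_cover k (frontier C) m G \<and> (\<forall>i<m. G i \<subseteq> C \<and> diameter (G i) < d)"
proof -
  have K: "compact C" "closed C" "bounded C"
    using C by (auto simp: convex_body_def compact_imp_closed compact_imp_bounded)
  have T: "closure S \<subseteq> C" "compact (closure S)"
    using closure_minimal[OF S(1) K(2)] bounded_subset[OF K(3) S(1)] by (simp_all add: compact_closure)
  have le: "dist x y \<le> d" if "x \<in> C" "y \<in> C" for x y
    using constant_width_dist_le[OF C d that] .
  have fC: "frontier C \<subseteq> C" using K by (simp add: frontier_subset_closed)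

  \<comment> \<open>Closures double the thickening, which happens at both points of a pair: hence the factor 4.\<close>
  obtain \<delta> where \<delta>: "0 < \<delta>" "\<And>i. i < m \<Longrightarrow> diameter (F i) + 4 * \<delta> < d"
  proof
    define D where "D = Max (insert 0 ((\<lambda>i. diameter (F i)) ` {..<m}))"
    have "D < d" using F(2) d by (auto simp: D_def)
    then show "0 < (d - D) / 8" by simp
    fix i assume "i < m"
    then have "diameter (F i) \<le> D" by (auto simp: D_def)
    then show "diameter (F i) + 4 * ((d - D) / 8) < d" using \<open>D < d\<close> by (simp add: field_simps)
  qed

  define R where "R = {p \<in> frontier C. \<forall>s\<in>S. \<delta> \<le> dist p s}"
  have "R = frontier C \<inter> (\<Inter>s\<in>S. {p. \<delta> \<le> dist p s})" by (auto simp: R_def)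
  moreover have "closed (frontier C \<inter> (\<Inter>s\<in>S. {p. \<delta> \<le> dist p s}))"
    by (intro closed_Int closed_INT ballI closed_Collect_le continuous_intros frontier_closed)
  ultimately have clR: "closed R" by simp
  have RT: "p \<notin> closure S" if "p \<in> R" for p
    using that \<delta>(1) by (force simp: R_def closure_approachable dist_commute)
  define partner where "partner p q e \<longleftrightarrow> q \<in> closure S \<and> e \<in> closure S \<and> dist p q = d \<and>
      dist e q = d \<and> (\<forall>q'\<in>C. dist p q' = d \<longrightarrow> q' = q)" for p q e
  have "\<exists>q e. partner p q e" if "p \<in> R" for p
    using frontier_partner_outside[OF C d T(2,1) S(2)] RT that by (auto simp: R_def partner_def)
  then obtain q e where "\<And>p. p \<in> R \<Longrightarrow> partner p (q p) (e p)"
    by metis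
  then have qe: "\<And>p. p \<in> R \<Longrightarrow> q p \<in> closure S" "\<And>p. p \<in> R \<Longrightarrow> e p \<in> closure S"
      "\<And>p. p \<in> R \<Longrightarrow> dist p (q p) = d" "\<And>p. p \<in> R \<Longrightarrow> dist (e p) (q p) = d"
      "\<And>p q'. p \<in> R \<Longrightarrow> q' \<in> C \<Longrightarrow> dist p q' = d \<Longrightarrow> q' = q p"
    by (simp_all add: partner_def)
  have "\<exists>t. t \<in> S \<and> dist t (e p) < \<delta>" if "p \<in> R" for p
    using qe(2)[OF that] \<delta>(1) unfolding closure_approachable by blast
  then obtain s where s: "\<And>p. p \<in> R \<Longrightarrow> s p \<in> S" "\<And>p. p \<in> R \<Longrightarrow> dist (s p) (e p) < \<delta>"
    by metis

  \<comment> \<open>Uniqueness of the partner describes the graph of \<open>q\<close> by a closed condition.\<close>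
  have contq: "continuous_on R q"
  proof (rule continuous_from_closed_graph[OF K(1)])
    show "q \<in> R \<rightarrow> C" using qe(1) T by blast
    have "(\<lambda>p. (p, q p)) ` R = (R \<times> C) \<inter> {z. dist (fst z) (snd z) = d}"
      using qe(1,3,5) T by (auto simp: image_iff)
    moreover have "closed ((R \<times> C) \<inter> {z. dist (fst z) (snd z) = d})"
      using clR K by (intro closed_Int closed_Times closed_Collect_eq continuous_intros)
    ultimately show "closed ((\<lambda>p. (p, q p)) ` R)" by simp
  qed

  define G1 G2 where "G1 i = {p \<in> frontier C. \<exists>f\<in>F i. dist p f \<le> \<delta>}"
    and "G2 i = {p \<in> R. s p \<in> F i}" for i
  have cl1: "\<exists>f\<in>F i. dist x f \<le> 2 * \<delta>" if x: "x \<in> closure (G1 i)" for x i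
  proof -
    obtain x' where "x' \<in> G1 i" "dist x' x < \<delta>" using x \<delta>(1) by (auto simp: closure_approachable)
    then obtain f where "f \<in> F i" "dist x' f \<le> \<delta>" by (auto simp: G1_def)
    then show ?thesis
      using dist_triangle[of x f x'] \<open>dist x' x < \<delta>\<close>
      by (intro bexI[of _ f]) (auto simp: dist_commute)
  qed
  have cl2R: "x \<in> R" if "x \<in> closure (G2 i)" for x i
    using that clR closure_minimal[of "G2 i" R] by (auto simp: G2_def)
  have cl2: "\<exists>f\<in>F i. d - 2 * \<delta> \<le> dist f (q x)" if x: "x \<in> closure (G2 i)" for x i
  proof -
    obtain \<eta> where \<eta>: "0 < \<eta>" "\<And>x'. x' \<in> R \<Longrightarrow> dist x' x < \<eta> \<Longrightarrow> dist (q x') (q x) < \<delta>"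
      using contq cl2R[OF x] \<delta>(1) unfolding continuous_on_iff by metis
    obtain x' where x': "x' \<in> G2 i" "dist x' x < \<eta>"
      using x \<eta>(1) by (auto simp: closure_approachable)
    then have R: "x' \<in> R" "s x' \<in> F i" by (auto simp: G2_def)
    have "dist (e x') (q x') \<le> dist (s x') (e x') + dist (s x') (q x) + dist (q x') (q x)"
      using dist_triangle[of "e x'" "q x'" "s x'"] dist_triangle[of "s x'" "q x'" "q x"]
      by (simp add: dist_commute)
    then have "d - 2 * \<delta> \<le> dist (s x') (q x)"
      using qe(4)[OF R(1)] s(2)[OF R(1)] \<eta>(2)[OF R(1) x'(2)] by linarith
    then show ?thesis using R by blast
  qed

  define G where "G i = G1 i \<union> G2 i" for i
  have GC: "G i \<subseteq> C" for i using fC by (auto simp: G_def G1_def G2_def R_def)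
  have far: "dist f f' < d - 4 * \<delta>" if "i < m" "f \<in> F i" "f' \<in> F i" for f f' i
    using diameter_bounded_bound[of "F i" f f'] F(2)[of i] \<delta>(2)[of i] that by simp
  have no: "dist x y \<noteq> d" if i: "i < m" and x: "x \<in> closure (G2 i)"
    and y: "y \<in> closure (G1 i) \<union> closure (G2 i)" for x y i
  proof
    assume xy: "dist x y = d"
    have "y \<in> closure (G i)" using y by (simp add: G_def)
    then have "y \<in> C" using closure_minimal[OF GC K(2)] by blast
    then have yq: "y = q x" using qe(5) cl2R[OF x] xy by blast
    then have "y \<notin> R" using RT qe(1) cl2R[OF x] by blast
    then have "y \<in> closure (G1 i)" using y cl2R by blast
    then obtain f where f: "f \<in> F i" "dist y f \<le> 2 * \<delta>" using cl1 by blast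
    obtain f' where f': "f' \<in> F i" "d - 2 * \<delta> \<le> dist f' y" using cl2[OF x] yq by blast
    show False using far[OF i f'(1) f(1)] f(2) f'(2) dist_triangle[of f' y f]
      by (simp add: dist_commute)
  qed
  have "diameter (G i) < d" if i: "i < m" for i
  proof -
    have b: "bounded (G i)" using GC K bounded_subset by blast
    have "dist x y < d" if xy: "x \<in> closure (G i)" "y \<in> closure (G i)" for x y
    proof -
      have "dist x y \<le> d" using xy closure_minimal[OF GC K(2)] le by blast
      moreover have "dist x y \<noteq> d"
      proof (cases "x \<in> closure (G2 i) \<or> y \<in> closure (G2 i)")
        case True
        then show ?thesis using no[OF i, of x y] no[OF i, of y x] xy
          by (auto simp: G_def dist_commute)
      next
        case False
        then have "x \<in> closure (G1 i)" "y \<in> closure (G1 i)" using xy by (auto simp: G_def)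
        then obtain f f' where "f \<in> F i" "f' \<in> F i" "dist x f \<le> 2 * \<delta>" "dist y f' \<le> 2 * \<delta>"
          using cl1 by meson
        then show ?thesis
          using far[OF i, of f f'] dist_triangle[of x y f] dist_triangle[of f y f']
          by (simp add: dist_commute)
      qed
      ultimately show ?thesis by simp
    qed
    then have "diameter (closure (G i)) < d"
      using b d by (intro diameter_less_compact) (auto simp: compact_closure)
    then show ?thesis using diameter_closure[OF b] by simp
  qed
  moreover have "kfold_cover k (frontier C) m G"
    unfolding kfold_cover_def
  proof
    fix p assume p: "p \<in> frontier C"
    \<comment> \<open>Each boundary point inherits the multiplicity of some point of \<open>S\<close>.\<close>
    obtain t where t: "t \<in> S" "\<And>i. t \<in> F i \<Longrightarrow> p \<in> G i"
    proof (cases "p \<in> R")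
      case True
      then show ?thesis using that[of "s p"] s(1) by (auto simp: G_def G2_def)
    next
      case False
      then obtain t where "t \<in> S" "dist p t < \<delta>" using p by (force simp: R_def)
      then show ?thesis using that[of t] p by (force simp: G_def G1_def)
    qed
    have "k \<le> card {i. i < m \<and> t \<in> F i}" using F(1) t(1) by (simp add: kfold_cover_def)
    also have "\<dots> \<le> card {i. i < m \<and> p \<in> G i}" using t(2) by (intro card_mono) auto
    finally show "k \<le> card {i. i < m \<and> p \<in> G i}" .
  qed
  ultimately show ?thesis using GC by blast
qed

lemma dist_le_convex_hull:
  fixes A :: "'a::real_normed_vector set"
  assumes "\<And>x y. x \<in> A \<Longrightarrow> y \<in> A \<Longrightarrow> dist x y \<le> r"
    and "x \<in> convex hull A" "y \<in> convex hull A"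
  shows "dist x y \<le> r"
proof -
  have "convex hull A \<subseteq> cball a r" if "a \<in> A" for a
    using assms(1) that by (intro hull_minimal) auto
  then have "x \<in> cball a r" if "a \<in> A" for a using assms(2) that by blast
  then have "A \<subseteq> cball x r" by (auto simp: dist_commute)
  then have "convex hull A \<subseteq> cball x r" by (intro hull_minimal) auto
  then show ?thesis using assms(3) by auto
qed

text \<open>
  Prolonging the segment from \<open>y\<close> to \<open>c\<close> by \<open>r\<close> beyond \<open>c\<close> stays in \<open>C\<close>.
\<close>

lemma interior_point_dist_less:
  fixes C :: "'a::euclidean_space set"
  assumes le: "\<And>x y. x \<in> C \<Longrightarrow> y \<in> C \<Longrightarrow> dist x y \<le> d" and r: "0 < r" "cball c r \<subseteq> C"
    and y: "y \<in> C" "y \<noteq> c"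
  shows "dist c y \<le> d - r"
proof -
  define t z where "t = r / dist c y" and "z = c + t *\<^sub>R (c - y)"
  have pos: "0 < dist c y" using y by simp
  then have t: "0 < t" "t * dist c y = r" using r by (simp_all add: t_def)
  have "dist c z = t * dist c y" using t by (simp add: z_def dist_norm)
  then have "dist z y \<le> d" using r y le t by auto
  moreover have "z - y = (1 + t) *\<^sub>R (c - y)"
    by (simp add: z_def algebra_simps)
  then have "dist z y = (1 + t) * dist c y"
    using t by (simp add: dist_norm)
  then have "dist z y = dist c y + r"
    using t by (simp add: distrib_right)
  ultimately show ?thesis by simp
qed

lemma in_segment_to_frontier:
  fixes C :: "'a::euclidean_space set"
  assumes C: "compact C" and x: "x \<in> C"
  shows "\<exists>y\<in>frontier C. x \<in> convex hull {c, y}"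
proof (cases "x \<in> frontier C")
  case True
  then show ?thesis by (intro bexI[of _ x]) (auto simp: hull_inc)
next
  case False
  then have xi: "x \<in> interior C" using x C by (simp add: frontier_def compact_imp_closed)
  \<comment> \<open>For \<open>x = c\<close> any direction serves, since \<open>c\<close> itself is an end of the segment.\<close>
  define l where "l = (if x = c then (SOME b. b \<in> Basis) else x - c)"
  have l: "l \<noteq> 0" using nonempty_Basis some_in_eq[of "Basis :: 'a set"] by (auto simp: l_def nonzero_Basis)
  obtain t where t: "0 < t" "x + t *\<^sub>R l \<in> frontier C"
    using ray_to_frontier[OF compact_imp_bounded[OF C] xi l] by blast
  have "x \<in> convex hull {c, x + t *\<^sub>R l}"
  proof (cases "x = c")
    case False
    define u where "u = 1 / (1 + t)"
    have u: "u * (1 + t) = 1" "0 \<le> u" "u \<le> 1" using t by (simp_all add: u_def)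
    have "(1 - u) *\<^sub>R c + u *\<^sub>R (x + t *\<^sub>R (x - c)) = (1 - u * (1 + t)) *\<^sub>R c + (u * (1 + t)) *\<^sub>R x"
      by (simp add: algebra_simps)
    then have "x = (1 - u) *\<^sub>R c + u *\<^sub>R (x + t *\<^sub>R (x - c))" by (simp add: u(1))
    then show ?thesis using u(2,3) False
      unfolding segment_convex_hull[symmetric] in_segment l_def
      by (intro exI[of _ u]) auto
  qed (simp add: hull_inc)
  then show ?thesis using t by blast
qed

text \<open>
  An interior point \<open>c\<close> is at distance less than \<open>d\<close> from all of \<open>C\<close>, uniformly, so adding \<open>c\<close> to each
  \<open>G i\<close> and taking convex hulls keeps the diameters below \<open>d\<close>. Every point of \<open>C\<close> is on a segment
  from \<open>c\<close> to a boundary point and inherits the multiplicity of that point.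
\<close>

lemma kfold_cover_extend_to_body:
  fixes C :: "'a::euclidean_space set"
  assumes C: "convex_body C" and le: "\<And>x y. x \<in> C \<Longrightarrow> y \<in> C \<Longrightarrow> dist x y \<le> d" and d: "0 < d"
    and G: "kfold_cover k (frontier C) m G" "\<And>i. i < m \<Longrightarrow> G i \<subseteq> C \<and> diameter (G i) < d"
  shows "\<exists>G'. kfold_cover k C m G' \<and> (\<forall>i<m. bounded (G' i) \<and> diameter (G' i) < d)"
proof -
  have K: "compact C" "bounded C" "interior C \<noteq> {}"
    using C by (auto simp: convex_body_def compact_imp_bounded)
  then obtain c where "c \<in> interior C" by blast
  then obtain r where r: "0 < r" "cball c r \<subseteq> C" using mem_interior_cball by blast
  define G' where "G' i = convex hull (insert c (G i))" for i
  have "bounded (G' i) \<and> diameter (G' i) < d" if i: "i < m" for i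
  proof -
    define M where "M = max (diameter (G i)) (max 0 (d - r))"
    have bG: "bounded (G i)" using G(2)[OF i] K bounded_subset by blast
    have cy: "dist c y \<le> M" if "y \<in> G i" for y
      using interior_point_dist_less[OF le r, of y] G(2)[OF i] that
      by (cases "y = c") (auto simp: M_def)
    then have yc: "dist y c \<le> M" if "y \<in> G i" for y
      using cy[OF that] by (simp add: dist_commute)
    have "dist x y \<le> M" if "x \<in> insert c (G i)" "y \<in> insert c (G i)" for x y
      using that cy[of y] yc[of x] diameter_bounded_bound[OF bG, of x y]
      by (auto simp: M_def)
    then have "diameter (G' i) \<le> M"
      unfolding G'_def
      by (intro diameter_le)
        (auto simp: dist_norm[symmetric] M_def intro: dist_le_convex_hull[of "insert c (G i)"])
    moreover have "M < d" using G(2)[OF i] d r by (simp add: M_def)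
    ultimately show ?thesis using bG by (simp add: G'_def bounded_convex_hull)
  qed
  moreover have "kfold_cover k C m G'"
    unfolding kfold_cover_def
  proof
    fix x assume "x \<in> C"
    then obtain y where y: "y \<in> frontier C" "x \<in> convex hull {c, y}"
      using in_segment_to_frontier[OF K(1)] by auto
    have "x \<in> G' i" if "y \<in> G i" for i
      using y(2) hull_mono[of "{c, y}" "insert c (G i)"] that by (auto simp: G'_def)
    then have "card {i. i < m \<and> y \<in> G i} \<le> card {i. i < m \<and> x \<in> G' i}"
      by (intro card_mono) auto
    then show "k \<le> card {i. i < m \<and> x \<in> G' i}"
      using G(1) y(1) unfolding kfold_cover_def by (meson le_trans)
  qed
  ultimately show ?thesis by blast
qed

lemma not_splits_below_if_borsuk_number_gt_2:
  fixes S :: "'a::euclidean_space set"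
  assumes "2 < borsuk_number S"
  shows "\<not> splits_below (diameter S) S"
proof
  assume "splits_below (diameter S) S"
  then obtain A B where AB: "bounded A" "bounded B" "S \<subseteq> A \<union> B"
      "diameter A < diameter S" "diameter B < diameter S"
    unfolding splits_below_def by blast
  define F where "F i = (if i = 0 then A else B)" for i :: nat
  have "kfold_cover 1 S 2 F"
    unfolding kfold_cover_def
  proof
    fix x assume "x \<in> S"
    then have "{i. i < 2 \<and> x \<in> F i} \<noteq> {}"
      using AB(3) by (cases "x \<in> A") (auto simp: F_def intro: exI[of _ 0] exI[of _ 1])
    then show "1 \<le> card {i. i < 2 \<and> x \<in> F i}" by (simp add: Suc_le_eq card_gt_0_iff)
  qed
  moreover have "\<forall>i<2. bounded (F i) \<and> diameter (F i) < diameter S"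
    using AB by (simp add: F_def)
  ultimately have "borsuk_number S \<le> 2"
    unfolding kfold_borsuk_number_def by (intro Least_le) auto
  then show False using assms by simp
qed

theorem theorem2:
  fixes S C :: "(real ^ 2) set" and d :: real and k :: nat
  assumes "bounded S" and "diameter S = d" and "d > 0"
    and "borsuk_number S = 3"
    and "convex_body C" and "has_constant_width C d" and "S \<subseteq> C"
    and "k \<ge> 1"
  shows "kfold_borsuk_number k S = kfold_borsuk_number k C"
proof -
  note C = assms(5,6) and d = assms(3) and SC = assms(7)
  have dC: "diameter C = d"
    using diameter_constant_width_superset[OF C d SC assms(2)] .
  have "\<not> splits_below d S"
    using not_splits_below_if_borsuk_number_gt_2[of S] assms(2,4) by simp
  then have ns: "\<not> splits_below d (closure S)"
    using closure_subset unfolding splits_below_def by (meson subset_trans)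
  \<comment> \<open>The two Borsuk numbers are minima of the same set of numbers \<open>m\<close>.\<close>
  have "(\<exists>F. kfold_cover k S m F \<and> (\<forall>i<m. bounded (F i) \<and> diameter (F i) < d)) \<longleftrightarrow>
        (\<exists>F. kfold_cover k C m F \<and> (\<forall>i<m. bounded (F i) \<and> diameter (F i) < d))" (is "?S \<longleftrightarrow> ?C") for m
  proof
    assume ?S
    then obtain F where F: "kfold_cover k S m F"
        "\<And>i. i < m \<Longrightarrow> bounded (F i) \<and> diameter (F i) < d"
      by blast
    obtain G where G: "kfold_cover k (frontier C) m G"
        "\<And>i. i < m \<Longrightarrow> G i \<subseteq> C \<and> diameter (G i) < d"
      using kfold_cover_extend_to_frontier[OF C d SC ns F] by blast
    show ?C
      using kfold_cover_extend_to_body[OF C(1) constant_width_dist_le[OF C d] d G] by blast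
  next
    assume ?C
    then show ?S using SC unfolding kfold_cover_def by blast
  qed
  then show ?thesis unfolding kfold_borsuk_number_def assms(2) dC by simp
qed

end
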